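(* Let $\mathcal{V}\in\Pi_{q,n}^{p,m}$, $\mathcal{U}\in\Pi_{s,n}^{r,m}$, and $\mathcal{Q}=\mathcal{Q}^*\in\Pi_{n,n}^{m,m}$ be 4-PI operators. Let $\mathcal{R}$ and $\mathcal{S}$ be right annihilators of $\mathcal{U}$ and $\mathcal{V}$, respectively. If there exists a 4-PI operator $\mathcal{X}$ of appropriate dimensions (i.e. $\mathcal{X}\in\Pi_{s,q}^{r,p}$) such that $$\mathcal{Q}+\mathcal{U}^*\mathcal{X}\mathcal{V}+\mathcal{V}^*\mathcal{X}^*\mathcal{U}\preccurlyeq 0,$$ then both of the following inequalities hold: $$\mathcal{S}^*\mathcal{Q}\mathcal{S}\preccurlyeq 0,\qquad \mathcal{R}^*\mathcal{Q}\mathcal{R}\preccurlyeq 0.$$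
   Context: $L_2^n[-1,0]$ is the space of Lebesgue square-integrable $\mathbb{R}^n$-valued functions on $[-1,0]$, and $\mathbb{R}L_2^{m,n}:=\mathbb{R}^m\times L_2^n[-1,0]$ with its natural Hilbert space inner product. 4-PI operators: $\Pi_{q,n}^{p,m}$ is the set of bounded linear operators $\mathcal{P}:\mathbb{R}L_2^{m,n}\to\mathbb{R}L_2^{p,q}$ of the form $$\Big(\mathcal{P}\begin{bmatrix}x\\ \mathbf{x}\end{bmatrix}\Big)(s)=\begin{bmatrix}Px+\int_{-1}^0Q_1(\theta)\mathbf{x}(\theta)\,d\theta\\ Q_2(s)x+R_0(s)\mathbf{x}(s)+\int_{-1}^sR_1(s,\theta)\mathbf{x}(\theta)\,d\theta+\int_s^0R_2(s,\theta)\mathbf{x}(\theta)\,d\theta\end{bmatrix},$$ where $P\in\mathbb{R}^{p\times m}$ is a matrix and $Q_1(s)\in\mathbb{R}^{p\times n}$, $Q_2(s)\in\mathbb{R}^{q\times m}$, $R_0(s),R_1(s,\theta),R_2(s,\theta)\in\mathbb{R}^{q\times n}$ are matrix-valued polynomials. Dimensions may be zero, in which case the corresponding parameters are absent. $\mathcal{P}^*$ denotes the Hilbert space adjoint. For self-adjoint $\mathcal{P}$, $\mathcal{P}\succcurlyeq0$ means $\langle\mathbf{x},\mathcal{P}\mathbf{x}\rangle\ge0$ for all $\mathbf{x}$, $\mathcal{P}\preccurlyeq 0$ means $-\mathcal{P}\succcurlyeq 0$, and $\mathcal{P}\succcurlyeq\mathcal{G}$ means $\mathcal{P}-\mathcal{G}\succcurlyeq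 0$. Right annihilator: given a 4-PI operator $\mathcal{W}\in\Pi_{q,n}^{p,m}$, a 4-PI operator $\mathcal{N}\in\Pi_{n,l}^{m,k}$ is a right annihilator of $\mathcal{W}$ if $\mathcal{W}(\mathcal{N}\mathbf{x})=0$ for all $\mathbf{x}\in\mathbb{R}L_2^{k,l}$ and $\mathcal{N}^*\mathcal{N}\succcurlyeq\epsilon I$ for some constant $\epsilon>0$. *)

theory Defs
  imports "HOL-Analysis.Analysis" "Jordan_Normal_Form.Matrix"
begin

section \<open>The scalar space \<open>L\<^sub>2[-1,0]\<close>\<close>

abbreviation leb :: "real measure" where
  "leb \<equiv> lebesgue_on {-1..0}"

definition sq_integrable :: "(real \<Rightarrow> real) \<Rightarrow> bool" where
  "sq_integrable f \<longleftrightarrow> f \<in> borel_measurable leb \<and> integrable leb (\<lambda>s. (f s)\<^sup>2)"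

definition L2_rel :: "(real \<Rightarrow> real) \<Rightarrow> (real \<Rightarrow> real) \<Rightarrow> bool" where
  "L2_rel f g \<longleftrightarrow> sq_integrable f \<and> sq_integrable g \<and> (AE s in leb. f s = g s)"

lemma sq_integrable_measurable [measurable_dest]: "sq_integrable f \<Longrightarrow> f \<in> borel_measurable leb"
  by (simp add: sq_integrable_def)

lemma sq_integrable_zero: "sq_integrable (\<lambda>_. 0)"
  by (simp add: sq_integrable_def)

lemma sq_integrable_mult:
  assumes "sq_integrable f" "sq_integrable g"
  shows "integrable leb (\<lambda>s. f s * g s)"
proof (rule Bochner_Integration.integrable_bound)
  show "integrable leb (\<lambda>s. (f s)\<^sup>2 + (g s)\<^sup>2)"
    using assms by (auto simp: sq_integrable_def)
  show "(\<lambda>s. f s * g s) \<in> borel_measurable leb"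
    using assms by (auto simp: sq_integrable_def)
  have "\<bar>a * b\<bar> \<le> a\<^sup>2 + b\<^sup>2" for a b :: real
  proof -
    have "2 * (\<bar>a\<bar> * \<bar>b\<bar>) \<le> a\<^sup>2 + b\<^sup>2"
      using zero_le_power2[of "\<bar>a\<bar> - \<bar>b\<bar>"] by (simp add: power2_diff)
    moreover have "0 \<le> \<bar>a\<bar> * \<bar>b\<bar>"
      by simp
    ultimately show ?thesis
      unfolding abs_mult by linarith
  qed
  thus "AE s in leb. norm (f s * g s) \<le> norm ((f s)\<^sup>2 + (g s)\<^sup>2)"
    by simp
qed

lemma sq_integrable_add:
  assumes "sq_integrable f" "sq_integrable g"
  shows "sq_integrable (\<lambda>s. f s + g s)"
  unfolding sq_integrable_def
proof
  show "(\<lambda>s. f s + g s) \<in> borel_measurable leb"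
    using assms by (auto simp: sq_integrable_def)
  have "integrable leb (\<lambda>s. (f s)\<^sup>2 + (g s)\<^sup>2 + 2 * (f s * g s))"
    using assms sq_integrable_mult[OF assms] by (auto simp: sq_integrable_def)
  thus "integrable leb (\<lambda>s. (f s + g s)\<^sup>2)"
    by (simp add: power2_sum mult.assoc)
qed

lemma sq_integrable_scale:
  assumes "sq_integrable f"
  shows "sq_integrable (\<lambda>s. c * f s)"
  using assms by (auto simp: sq_integrable_def power_mult_distrib)

quotient_type L2 = "real \<Rightarrow> real" / partial: L2_rel
proof (rule part_equivpI)
  show "\<exists>f. L2_rel f f"
    using sq_integrable_zero by (auto simp: L2_rel_def)
  show "symp L2_rel"
    by (auto simp: symp_def L2_rel_def)
  show "transp L2_rel"
    by (auto simp: transp_def L2_rel_def elim: AE_mp)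
qed

instantiation L2 :: real_inner
begin

lift_definition zero_L2 :: L2 is "\<lambda>_. 0"
  by (simp add: L2_rel_def sq_integrable_zero)

lift_definition plus_L2 :: "L2 \<Rightarrow> L2 \<Rightarrow> L2" is "\<lambda>f g s. f s + g s"
  by (auto simp: L2_rel_def intro: sq_integrable_add)

lift_definition scaleR_L2 :: "real \<Rightarrow> L2 \<Rightarrow> L2" is "\<lambda>c f s. c * f s"
  by (auto simp: L2_rel_def intro: sq_integrable_scale)

definition uminus_L2 :: "L2 \<Rightarrow> L2" where
  "uminus_L2 f = (-1) *\<^sub>R f"

definition minus_L2 :: "L2 \<Rightarrow> L2 \<Rightarrow> L2" where
  "minus_L2 f g = f + (- g)"

lift_definition inner_L2 :: "L2 \<Rightarrow> L2 \<Rightarrow> real" is "\<lambda>f g. LINT s|leb. f s * g s"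
proof -
  fix f f' g g' :: "real \<Rightarrow> real"
  assume rel: "L2_rel f f'" "L2_rel g g'"
  show "(LINT s|leb. f s * g s) = (LINT s|leb. f' s * g' s)"
  proof (rule integral_cong_AE)
    show "(\<lambda>s. f s * g s) \<in> borel_measurable leb" "(\<lambda>s. f' s * g' s) \<in> borel_measurable leb"
      using rel by (auto simp: L2_rel_def sq_integrable_def)
    show "AE s in leb. f s * g s = f' s * g' s"
      using rel by (auto simp: L2_rel_def)
  qed
qed

definition norm_L2 :: "L2 \<Rightarrow> real" where
  "norm_L2 f = sqrt (inner f f)"

definition dist_L2 :: "L2 \<Rightarrow> L2 \<Rightarrow> real" where
  "dist_L2 f g = norm (f - g)"

definition sgn_L2 :: "L2 \<Rightarrow> L2" where
  "sgn_L2 f = inverse (norm f) *\<^sub>R f"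

definition uniformity_L2 :: "(L2 \<times> L2) filter" where
  "uniformity_L2 = (INF e\<in>{0<..}. principal {(x, y). dist x y < e})"

definition open_L2 :: "L2 set \<Rightarrow> bool" where
  "open_L2 U \<longleftrightarrow> (\<forall>x\<in>U. eventually (\<lambda>(x', y). x' = x \<longrightarrow> y \<in> U) uniformity)"

instance
proof
  fix f g h :: L2 and a b :: real
  have relI: "L2_rel u v" if "sq_integrable u" "u = v" for u v
    using that by (simp add: L2_rel_def)
  note sq = sq_integrable_zero sq_integrable_add sq_integrable_scale
  show "f + g + h = f + (g + h)"
    by transfer (auto intro!: relI sq simp: L2_rel_def add.assoc)
  show "f + g = g + f"
    by transfer (auto intro!: relI sq simp: L2_rel_def add.commute)
  show "0 + f = f"
    by transfer (auto intro!: relI sq simp: L2_rel_def)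
  show "- f + f = 0"
    unfolding uminus_L2_def by transfer (auto intro!: relI sq simp: L2_rel_def)
  show "f - g = f + - g"
    by (simp add: minus_L2_def)
  show "a *\<^sub>R (f + g) = a *\<^sub>R f + a *\<^sub>R g"
    by transfer (auto intro!: relI sq simp: L2_rel_def distrib_left)
  show "(a + b) *\<^sub>R f = a *\<^sub>R f + b *\<^sub>R f"
    by transfer (auto intro!: relI sq simp: L2_rel_def distrib_right)
  show "a *\<^sub>R b *\<^sub>R f = (a * b) *\<^sub>R f"
    by transfer (auto intro!: relI sq simp: L2_rel_def mult.assoc)
  show "1 *\<^sub>R f = f"
    by transfer (auto intro!: relI sq simp: L2_rel_def)
  show "dist f g = norm (f - g)"
    by (simp add: dist_L2_def)
  show "sgn f = inverse (norm f) *\<^sub>R f"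
    by (simp add: sgn_L2_def)
  show "uniformity = (INF e\<in>{0<..}. principal {(x :: L2, y). dist x y < e})"
    by (simp add: uniformity_L2_def)
  show "open U \<longleftrightarrow> (\<forall>x\<in>U. eventually (\<lambda>(x', y). x' = x \<longrightarrow> y \<in> U) uniformity)" for U :: "L2 set"
    by (simp add: open_L2_def)
  show "inner f g = inner g f"
    by transfer (simp add: mult.commute)
  show "inner (f + g) h = inner f h + inner g h"
    by transfer (auto simp: L2_rel_def distrib_right sq_integrable_mult)
  show "inner (a *\<^sub>R f) g = a * inner f g"
    by transfer (simp add: mult.assoc)
  show "0 \<le> inner f f"
    by transfer simp
  show "inner f f = 0 \<longleftrightarrow> f = 0"
  proof transfer
    fix f :: "real \<Rightarrow> real"
    assume "L2_rel f f"
    hence f: "sq_integrable f" by (simp add: L2_rel_def)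
    have "(LINT s|leb. f s * f s) = 0 \<longleftrightarrow> (AE s in leb. f s * f s = 0)"
      using sq_integrable_mult[OF f f] by (intro integral_nonneg_eq_0_iff_AE) auto
    thus "(LINT s|leb. f s * f s) = 0 \<longleftrightarrow> L2_rel f (\<lambda>_. 0)"
      using f sq_integrable_zero by (simp add: L2_rel_def)
  qed
  show "norm f = sqrt (inner f f)"
    by (simp add: norm_L2_def)
qed

end

section \<open>The spaces \<open>\<real>L\<^sub>2\<^bsup>m,n\<^esup>\<close>\<close>

text \<open>An element of \<open>L\<^sub>2\<^bsup>n\<^esup>[-1,0]\<close> is given by its \<open>n\<close> component classes; \<open>value_at\<close> and
  \<open>L2_of_fun\<close> translate to and from \<open>\<real>\<^sup>n\<close>-valued functions. The choice of representative
  in \<open>value_at\<close> only matters on a null set. All dimensions are allowed to be \<open>0\<close>.\<close>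

type_synonym rl2 = "real vec \<times> L2 vec"
type_synonym rl2_op = "rl2 \<Rightarrow> rl2"

definition RL2 :: "nat \<Rightarrow> nat \<Rightarrow> rl2 set" where
  "RL2 m n = carrier_vec m \<times> carrier_vec n"

definition value_at :: "L2 vec \<Rightarrow> real \<Rightarrow> real vec" where
  "value_at f s = map_vec (\<lambda>g. rep_L2 g s) f"

definition L2_of_fun :: "nat \<Rightarrow> (real \<Rightarrow> real vec) \<Rightarrow> L2 vec" where
  "L2_of_fun n f = vec n (\<lambda>i. abs_L2 (\<lambda>s. f s $ i))"

definition rl2_zero :: "nat \<Rightarrow> nat \<Rightarrow> rl2" where
  "rl2_zero m n = (0\<^sub>v m, 0\<^sub>v n)"

definition rl2_scale :: "real \<Rightarrow> rl2 \<Rightarrow> rl2" where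
  "rl2_scale c u = (c \<cdot>\<^sub>v fst u, map_vec (scaleR c) (snd u))"

definition rl2_inner :: "rl2 \<Rightarrow> rl2 \<Rightarrow> real" where
  "rl2_inner u v = scalar_prod (fst u) (fst v)
     + (\<Sum>i<dim_vec (snd v). inner (snd u $ i) (snd v $ i))"

definition rl2_norm :: "rl2 \<Rightarrow> real" where
  "rl2_norm u = sqrt (rl2_inner u u)"

section \<open>Bounded operators\<close>

text \<open>Operators \<open>\<real>L\<^sub>2\<^bsup>m,n\<^esup> \<rightarrow> \<real>L\<^sub>2\<^bsup>p,q\<^esup>\<close> are extensional functions, so that HOL equality is equality
  of operators.\<close>

definition bounded_ops :: "nat \<Rightarrow> nat \<Rightarrow> nat \<Rightarrow> nat \<Rightarrow> rl2_op set" where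
  "bounded_ops m n p q = {T \<in> RL2 m n \<rightarrow>\<^sub>E RL2 p q.
     (\<forall>u\<in>RL2 m n. \<forall>v\<in>RL2 m n. T (u + v) = T u + T v) \<and>
     (\<forall>c. \<forall>u\<in>RL2 m n. T (rl2_scale c u) = rl2_scale c (T u)) \<and>
     (\<exists>C. \<forall>u\<in>RL2 m n. rl2_norm (T u) \<le> C * rl2_norm u)}"

text \<open>The Hilbert space adjoint of an operator \<open>T : \<real>L\<^sub>2\<^bsup>m,n\<^esup> \<rightarrow> \<real>L\<^sub>2\<^bsup>p,q\<^esup>\<close>.\<close>

definition hadj :: "nat \<Rightarrow> nat \<Rightarrow> nat \<Rightarrow> nat \<Rightarrow> rl2_op \<Rightarrow> rl2_op" where
  "hadj m n p q T = (THE A. A \<in> bounded_ops p q m n \<and>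
     (\<forall>u\<in>RL2 m n. \<forall>v\<in>RL2 p q. rl2_inner (T u) v = rl2_inner u (A v)))"

text \<open>The order on operators \<open>\<real>L\<^sub>2\<^bsup>m,n\<^esup> \<rightarrow> \<real>L\<^sub>2\<^bsup>m,n\<^esup>\<close>; meant for self-adjoint arguments.\<close>

definition op_nonneg :: "nat \<Rightarrow> nat \<Rightarrow> rl2_op \<Rightarrow> bool" where
  "op_nonneg m n T \<longleftrightarrow> (\<forall>u\<in>RL2 m n. 0 \<le> rl2_inner u (T u))"

definition op_nonpos :: "nat \<Rightarrow> nat \<Rightarrow> rl2_op \<Rightarrow> bool" where
  "op_nonpos m n T \<longleftrightarrow> op_nonneg m n (\<lambda>u. - T u)"

definition op_ge :: "nat \<Rightarrow> nat \<Rightarrow> rl2_op \<Rightarrow> rl2_op \<Rightarrow> bool" where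
  "op_ge m n T G \<longleftrightarrow> op_nonneg m n (\<lambda>u. T u - G u)"

section \<open>4-PI operators\<close>

text \<open>A matrix of bivariate polynomials \<open>R(s,\<theta>)\<close> has entries in \<open>(\<real>[\<theta>])[s]\<close>.\<close>

definition eval1 :: "real poly mat \<Rightarrow> real \<Rightarrow> real mat" where
  "eval1 A s = map_mat (\<lambda>a. poly a s) A"

definition eval2 :: "real poly poly mat \<Rightarrow> real \<Rightarrow> real \<Rightarrow> real mat" where
  "eval2 A s \<theta> = map_mat (\<lambda>a. poly (poly a [:s:]) \<theta>) A"

definition vec_integral :: "nat \<Rightarrow> real set \<Rightarrow> (real \<Rightarrow> real vec) \<Rightarrow> real vec" where
  "vec_integral p S f = vec p (\<lambda>i. LINT \<theta>|lebesgue_on S. f \<theta> $ i)"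

definition pi_map :: "real mat \<Rightarrow> real poly mat \<Rightarrow> real poly mat \<Rightarrow> real poly mat \<Rightarrow>
    real poly poly mat \<Rightarrow> real poly poly mat \<Rightarrow> rl2_op" where
  "pi_map P Q\<^sub>1 Q\<^sub>2 R\<^sub>0 R\<^sub>1 R\<^sub>2 u =
     (let x = fst u; f = value_at (snd u); p = dim_row P; q = dim_row R\<^sub>0 in
       (P *\<^sub>v x + vec_integral p {-1..0} (\<lambda>\<theta>. eval1 Q\<^sub>1 \<theta> *\<^sub>v f \<theta>),
        L2_of_fun q (\<lambda>s. eval1 Q\<^sub>2 s *\<^sub>v x + eval1 R\<^sub>0 s *\<^sub>v f s
          + vec_integral q {-1..s} (\<lambda>\<theta>. eval2 R\<^sub>1 s \<theta> *\<^sub>v f \<theta>)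
          + vec_integral q {s..0} (\<lambda>\<theta>. eval2 R\<^sub>2 s \<theta> *\<^sub>v f \<theta>))))"

text \<open>\<open>four_PI m n p q\<close> is \<open>\<Pi>\<close> with upper indices \<open>p,m\<close> and lower indices \<open>q,n\<close>: operators
  \<open>\<real>L\<^sub>2\<^bsup>m,n\<^esup> \<rightarrow> \<real>L\<^sub>2\<^bsup>p,q\<^esup>\<close>.\<close>

definition four_PI :: "nat \<Rightarrow> nat \<Rightarrow> nat \<Rightarrow> nat \<Rightarrow> rl2_op set" where
  "four_PI m n p q = {T \<in> bounded_ops m n p q.
     \<exists>P\<in>carrier_mat p m. \<exists>Q\<^sub>1\<in>carrier_mat p n. \<exists>Q\<^sub>2\<in>carrier_mat q m.
     \<exists>R\<^sub>0\<in>carrier_mat q n. \<exists>R\<^sub>1\<in>carrier_mat q n. \<exists>R\<^sub>2\<in>carrier_mat q n.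
       \<forall>u\<in>RL2 m n. T u = pi_map P Q\<^sub>1 Q\<^sub>2 R\<^sub>0 R\<^sub>1 R\<^sub>2 u}"

text \<open>\<open>N : \<real>L\<^sub>2\<^bsup>k,l\<^esup> \<rightarrow> \<real>L\<^sub>2\<^bsup>m,n\<^esup>\<close> is a right annihilator of \<open>W : \<real>L\<^sub>2\<^bsup>m,n\<^esup> \<rightarrow> \<real>L\<^sub>2\<^bsup>p,q\<^esup>\<close>.\<close>

definition right_annihilator ::
    "nat \<Rightarrow> nat \<Rightarrow> nat \<Rightarrow> nat \<Rightarrow> nat \<Rightarrow> nat \<Rightarrow> rl2_op \<Rightarrow> rl2_op \<Rightarrow> bool" where
  "right_annihilator k l m n p q W N \<longleftrightarrow> N \<in> four_PI k l m n \<and>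
     (\<forall>u\<in>RL2 k l. W (N u) = rl2_zero p q) \<and>
     (\<exists>\<epsilon>>0. op_ge k l (\<lambda>u. hadj k l m n N (N u)) (rl2_scale \<epsilon>))"

end

theory Submission
  imports Defs
begin

text \<open>This is the easy direction of the projection (Finsler) lemma. Moving all adjoints to the other
  side of the inner product, the quadratic form of \<open>Q + U\<^sup>* X V + V\<^sup>* X\<^sup>* U\<close> at \<open>w\<close> is
  \<open>\<langle>w, Q w\<rangle> + 2 \<langle>U w, X (V w)\<rangle>\<close>. On the range of a right annihilator \<open>N\<close> of \<open>U\<close> or of \<open>V\<close> the second
  term is zero, so \<open>\<langle>u, N\<^sup>* Q N u\<rangle> = \<langle>N u, Q (N u)\<rangle> \<le> 0\<close>; this is lemma \<open>compression_nonpos\<close>.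

  The substance lies in the legitimacy of moving the adjoints, that is, in their existence
  (\<open>hadj_properties\<close>). It is a Hilbert space fact about bounded operators: \<open>L\<^sub>2[-1,0]\<close> is complete (Riesz-Fischer), bounded
  functionals on a complete inner product space are represented by vectors
  (\<open>riesz_representation\<close>), and this carries over entry by entry to \<open>\<real>L\<^sub>2\<^bsup>m,n\<^esup>\<close>.\<close>

section \<open>Completeness of \<open>L\<^sub>2[-1,0]\<close>\<close>

lemma sq_integrable_rep: "sq_integrable (rep_L2 f)"
  using Quotient3_rep_reflp[OF Quotient3_L2] by (auto simp: L2_rel_def)

lemma abs_rep_L2: "abs_L2 (rep_L2 f) = f"
  by (rule Quotient3_abs_rep[OF Quotient3_L2])

lemma norm_abs_L2:
  assumes "sq_integrable u"
  shows "(norm (abs_L2 u))\<^sup>2 = (LINT s|leb. (u s)\<^sup>2)"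
  using inner_L2.abs_eq[of u u] assms
  unfolding power2_norm_eq_inner by (simp add: L2_rel_def power2_eq_square)

lemma abs_L2_diff:
  assumes "sq_integrable u" "sq_integrable v"
  shows "abs_L2 u - abs_L2 v = abs_L2 (\<lambda>s. u s - v s)"
proof -
  have neg: "sq_integrable (\<lambda>s. -1 * v s)"
    by (rule sq_integrable_scale[OF assms(2)])
  have "abs_L2 u - abs_L2 v = abs_L2 u + abs_L2 (\<lambda>s. -1 * v s)"
    unfolding minus_L2_def uminus_L2_def
    by (subst scaleR_L2.abs_eq) (auto simp: L2_rel_def assms)
  also have "\<dots> = abs_L2 (\<lambda>s. u s + -1 * v s)"
    by (rule plus_L2.abs_eq) (use assms neg in \<open>auto simp: L2_rel_def\<close>)
  finally show ?thesis by simp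
qed

lemma sq_integrable_diff:
  assumes "sq_integrable u" "sq_integrable v"
  shows "sq_integrable (\<lambda>s. u s - v s)"
  using sq_integrable_add[OF assms(1) sq_integrable_scale[OF assms(2), of "-1"]] by simp

text \<open>On an interval of length one the \<open>L\<^sub>1\<close> norm is at most the \<open>L\<^sub>2\<close> norm, by Cauchy-Schwarz
  against the constant function \<open>1\<close>. This is what allows a Cauchy sequence in \<open>L\<^sub>2\<close> to be treated
  by the \<open>L\<^sub>1\<close> theory.\<close>

lemma integral_abs_le_norm:
  assumes "sq_integrable u"
  shows "(LINT s|leb. \<bar>u s\<bar>) \<le> norm (abs_L2 u)"
proof -
  have one: "sq_integrable (\<lambda>_. 1)"
    by (simp add: sq_integrable_def)
  have au: "sq_integrable (\<lambda>s. \<bar>u s\<bar>)"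
    using assms by (auto simp: sq_integrable_def)
  have "(LINT s|leb. \<bar>u s\<bar>) = inner (abs_L2 (\<lambda>s. \<bar>u s\<bar>)) (abs_L2 (\<lambda>_. 1))"
    using au one by (simp add: inner_L2.abs_eq L2_rel_def)
  also have "\<dots> \<le> norm (abs_L2 (\<lambda>s. \<bar>u s\<bar>)) * norm (abs_L2 (\<lambda>_. 1))"
    by (rule norm_cauchy_schwarz)
  also have "norm (abs_L2 (\<lambda>s. \<bar>u s\<bar>)) = norm (abs_L2 u)"
  proof (rule power2_eq_imp_eq)
    show "(norm (abs_L2 (\<lambda>s. \<bar>u s\<bar>)))\<^sup>2 = (norm (abs_L2 u))\<^sup>2"
      unfolding norm_abs_L2[OF au] norm_abs_L2[OF assms] power2_abs ..
  qed (rule norm_ge_zero)+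
  also have "norm (abs_L2 (\<lambda>_. 1)) = 1"
  proof (rule power2_eq_imp_eq)
    show "(norm (abs_L2 (\<lambda>_. 1)))\<^sup>2 = 1\<^sup>2"
      unfolding norm_abs_L2[OF one] by (simp add: measure_restrict_space)
  qed simp_all
  finally show ?thesis by simp
qed

text \<open>Fatou's lemma for the squares: closed balls of \<open>L\<^sub>2\<close> are closed under almost everywhere
  convergence. Square integrability of the limit is part of the conclusion, because only then does
  its class in \<open>L\<^sub>2\<close> have a meaningful norm.\<close>

lemma fatou_sq_integrable:
  assumes v: "\<And>i. sq_integrable (v i)"
    and lim: "AE s in leb. (\<lambda>i. v i s) \<longlonglongrightarrow> w s"
    and w [measurable]: "w \<in> borel_measurable leb"
    and bound: "\<And>i. norm (abs_L2 (v i)) \<le> e"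
  shows "sq_integrable w \<and> norm (abs_L2 w) \<le> e"
proof -
  have e0: "0 \<le> e"
    using bound[of 0] norm_ge_zero order_trans by blast
  have [measurable]: "v i \<in> borel_measurable leb" for i
    using v by (simp add: sq_integrable_def)
  have step: "(\<integral>\<^sup>+ s. ennreal ((v i s)\<^sup>2) \<partial>leb) \<le> ennreal (e\<^sup>2)" for i
  proof -
    have "(\<integral>\<^sup>+ s. ennreal ((v i s)\<^sup>2) \<partial>leb) = ennreal ((norm (abs_L2 (v i)))\<^sup>2)"
      unfolding norm_abs_L2[OF v] using v[of i]
      by (intro nn_integral_eq_integral) (auto simp: sq_integrable_def)
    also have "\<dots> \<le> ennreal (e\<^sup>2)"
      using bound by (intro ennreal_leI power_mono) auto
    finally show ?thesis .
  qed
  have "(\<integral>\<^sup>+ s. ennreal ((w s)\<^sup>2) \<partial>leb) = (\<integral>\<^sup>+ s. liminf (\<lambda>i. ennreal ((v i s)\<^sup>2)) \<partial>leb)"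
  proof (rule nn_integral_cong_AE)
    show "AE s in leb. ennreal ((w s)\<^sup>2) = liminf (\<lambda>i. ennreal ((v i s)\<^sup>2))"
      using lim
    proof eventually_elim
      case (elim s)
      then have "(\<lambda>i. ennreal ((v i s)\<^sup>2)) \<longlonglongrightarrow> ennreal ((w s)\<^sup>2)"
        by (intro tendsto_ennrealI tendsto_power)
      then show ?case
        using lim_imp_Liminf by (metis sequentially_bot)
    qed
  qed
  also have "\<dots> \<le> liminf (\<lambda>i. \<integral>\<^sup>+ s. ennreal ((v i s)\<^sup>2) \<partial>leb)"
    by (rule nn_integral_liminf) simp
  also have "\<dots> \<le> liminf (\<lambda>i. ennreal (e\<^sup>2))"
    by (rule Liminf_mono) (simp add: step)
  also have "\<dots> = ennreal (e\<^sup>2)"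
    by (simp add: Liminf_const)
  finally have le: "(\<integral>\<^sup>+ s. ennreal ((w s)\<^sup>2) \<partial>leb) \<le> ennreal (e\<^sup>2)" .
  have int: "integrable leb (\<lambda>s. (w s)\<^sup>2)"
    using le by (intro integrableI_bounded) (auto simp: le_less_trans)
  then have sq: "sq_integrable w"
    using w by (simp add: sq_integrable_def)
  have "ennreal ((norm (abs_L2 w))\<^sup>2) \<le> ennreal (e\<^sup>2)"
    using le nn_integral_eq_integral[OF int] by (simp add: norm_abs_L2[OF sq])
  then have "(norm (abs_L2 w))\<^sup>2 \<le> e\<^sup>2"
    by (simp add: ennreal_le_iff)
  then show ?thesis
    using sq e0 power2_le_imp_le by blast
qed

text \<open>Riesz-Fischer. A Cauchy sequence in \<open>L\<^sub>2\<close> is Cauchy in \<open>L\<^sub>1\<close>, so a subsequence converges almost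
  everywhere to some \<open>w\<close>. The differences \<open>u\<^bsub>r i\<^esub> - u\<^sub>n\<close> with \<open>i\<close> and \<open>n\<close> large are uniformly small, and
  Fatou's lemma passes this smallness on to \<open>w - u\<^sub>n\<close>: the whole sequence converges to \<open>w\<close> in norm.\<close>

instance L2 :: complete_space
proof
  fix X :: "nat \<Rightarrow> L2"
  assume "Cauchy X"
  define u where "u n = rep_L2 (X n)" for n
  have u: "sq_integrable (u n)" for n
    by (simp add: u_def sq_integrable_rep)
  then have [measurable]: "u n \<in> borel_measurable leb" for n
    by (simp add: sq_integrable_def)
  have dist_u: "norm (abs_L2 (\<lambda>s. u i s - u j s)) = dist (X i) (X j)" for i j
    using abs_L2_diff[OF u u] by (simp add: u_def abs_rep_L2 dist_norm)
  have int_u: "integrable leb (u n)" for n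
    using sq_integrable_mult[OF u[of n], of "\<lambda>_. 1"] by (simp add: sq_integrable_def)
  have "\<exists>N. \<forall>i\<ge>N. \<forall>j\<ge>N. (LINT s|leb. norm (u i s - u j s)) < e" if "e > 0" for e
  proof -
    obtain N where N: "\<And>i j. i \<ge> N \<Longrightarrow> j \<ge> N \<Longrightarrow> dist (X i) (X j) < e"
      using \<open>Cauchy X\<close> \<open>e > 0\<close> unfolding Cauchy_def by blast
    have "(LINT s|leb. norm (u i s - u j s)) < e" if "i \<ge> N" "j \<ge> N" for i j
      using integral_abs_le_norm[OF sq_integrable_diff[OF u u], of i j] N[OF that]
      by (simp add: dist_u)
    then show ?thesis by blast
  qed
  then obtain r where r: "strict_mono r" and AE: "AE s in leb. Cauchy (\<lambda>i. u (r i) s)"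
    using cauchy_L1_AE_cauchy_subseq[of leb u] int_u by blast
  define w where "w s = lim (\<lambda>i. u (r i) s)" for s
  have [measurable]: "w \<in> borel_measurable leb"
    unfolding w_def by measurable
  have lim: "AE s in leb. (\<lambda>i. u (r i) s) \<longlonglongrightarrow> w s"
    using AE by eventually_elim (simp add: w_def Cauchy_convergent_iff convergent_LIMSEQ_iff)
  \<comment> \<open>Shifting \<open>i\<close> by \<open>N\<close> makes the bound hold for every term of the sequence, not only eventually.\<close>
  have tail: "sq_integrable (\<lambda>s. w s - u n s) \<and> norm (abs_L2 (\<lambda>s. w s - u n s)) \<le> e"
    if N: "\<And>i j. i \<ge> N \<Longrightarrow> j \<ge> N \<Longrightarrow> dist (X i) (X j) < e" and n: "n \<ge> N" for N n e
  proof (rule fatou_sq_integrable[where v = "\<lambda>i s. u (r (i + N)) s - u n s"])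
    show "sq_integrable (\<lambda>s. u (r (i + N)) s - u n s)" for i
      by (intro sq_integrable_diff u)
    show "AE s in leb. (\<lambda>i. u (r (i + N)) s - u n s) \<longlonglongrightarrow> w s - u n s"
      using lim
    proof eventually_elim
      case (elim s)
      from LIMSEQ_ignore_initial_segment[OF this, of N] show ?case
        by (intro tendsto_diff tendsto_const)
    qed
    show "norm (abs_L2 (\<lambda>s. u (r (i + N)) s - u n s)) \<le> e" for i
      using N[of "r (i + N)" n] n seq_suble[OF r, of "i + N"] by (simp add: dist_u)
  qed simp
  have cau: "\<exists>N. \<forall>i\<ge>N. \<forall>j\<ge>N. dist (X i) (X j) < e" if "e > 0" for e
    using \<open>Cauchy X\<close> that unfolding Cauchy_def by blast
  obtain N where N: "\<And>i j. i \<ge> N \<Longrightarrow> j \<ge> N \<Longrightarrow> dist (X i) (X j) < 1"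
    using cau[of 1] by auto
  have "sq_integrable (\<lambda>s. (w s - u N s) + u N s)"
    using tail[OF N, of N] u by (intro sq_integrable_add) auto
  then have w: "sq_integrable w" by simp
  have "X \<longlonglongrightarrow> abs_L2 w"
  proof (rule metric_LIMSEQ_I)
    fix e :: real assume "0 < e"
    then obtain N where N: "\<And>i j. i \<ge> N \<Longrightarrow> j \<ge> N \<Longrightarrow> dist (X i) (X j) < e / 2"
      using cau[of "e / 2"] by auto
    have "dist (X n) (abs_L2 w) < e" if "n \<ge> N" for n
    proof -
      have "dist (X n) (abs_L2 w) = norm (abs_L2 (\<lambda>s. w s - u n s))"
        using abs_L2_diff[OF w u, of n] by (simp add: u_def abs_rep_L2 dist_norm norm_minus_commute)
      also have "\<dots> \<le> e / 2"
        using tail[OF N that] by simp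
      also have "\<dots> < e" using \<open>0 < e\<close> by simp
      finally show ?thesis .
    qed
    then show "\<exists>N. \<forall>n\<ge>N. dist (X n) (abs_L2 w) < e" by blast
  qed
  then show "convergent X" by (auto simp: convergent_def)
qed

section \<open>Riesz representation\<close>

text \<open>The representing vector is the minimiser of \<open>J g = \<parallel>g\<parallel>\<^sup>2 - 2 \<phi> g\<close>. Boundedness of \<open>\<phi>\<close> bounds \<open>J\<close> from
  below, the parallelogram law makes every minimising sequence Cauchy, and completeness supplies its
  limit \<open>w\<close>. The first variation of \<open>J\<close> at \<open>w\<close> in the direction \<open>g\<close> is \<open>2 (inner g w - \<phi> g)\<close>, which
  has to vanish.\<close>

lemma riesz_representation:
  fixes \<phi> :: "'a::{real_inner, complete_space} \<Rightarrow> real"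
  assumes "bounded_linear \<phi>"
  shows "\<exists>w. \<forall>g. \<phi> g = inner g w"
proof -
  interpret bounded_linear \<phi> by fact
  obtain K where K: "\<And>g. norm (\<phi> g) \<le> norm g * K"
    using bounded by blast
  define J where "J g = (norm g)\<^sup>2 - 2 * \<phi> g" for g
  have lower: "- K\<^sup>2 \<le> J g" for g
  proof -
    have "0 \<le> (norm g - K)\<^sup>2" by simp
    then show ?thesis
      using K[of g] by (simp add: J_def power2_diff)
  qed
  define d where "d = (INF g. J g)"
  have bdd: "bdd_below (range J)"
    using lower by (intro bdd_belowI2)
  have d_le: "d \<le> J g" for g
    unfolding d_def using bdd by (rule cINF_lower) simp
  have "\<exists>g. J g < d + 1 / real (Suc i)" for i
  proof -
    have "(INF g. J g) < d + 1 / real (Suc i)"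
      unfolding d_def by simp
    then show ?thesis
      using bdd by (subst (asm) cINF_less_iff) auto
  qed
  then obtain X where X: "\<And>i. J (X i) < d + 1 / real (Suc i)"
    by metis
  have para: "(norm (g - h))\<^sup>2 \<le> 2 * (J g - d) + 2 * (J h - d)" for g h
  proof -
    have "(norm (g - h))\<^sup>2 = 2 * J g + 2 * J h - 4 * J ((1 / 2) *\<^sub>R (g + h))"
      unfolding J_def power2_norm_eq_inner
      by (simp add: add scaleR inner_simps inner_commute[of h g] field_simps)
    then show ?thesis
      using d_le[of "(1 / 2) *\<^sub>R (g + h)"] by simp
  qed
  have "Cauchy X"
  proof (rule metric_CauchyI)
    fix e :: real assume "0 < e"
    obtain N where N: "1 / real (Suc N) < e\<^sup>2 / 4"
      using \<open>0 < e\<close> nat_approx_posE[of "e\<^sup>2 / 4"] by auto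
    have small: "J (X i) - d < e\<^sup>2 / 4" if "i \<ge> N" for i
    proof -
      have "1 / real (Suc i) \<le> 1 / real (Suc N)"
        using that by (intro divide_left_mono) auto
      then show ?thesis using X[of i] N by linarith
    qed
    have "dist (X i) (X j) < e" if "i \<ge> N" "j \<ge> N" for i j
    proof -
      have "(norm (X i - X j))\<^sup>2 < e\<^sup>2"
      proof (rule le_less_trans[OF para])
        have "2 * a + 2 * b < c" if "a < c / 4" "b < c / 4" for a b c :: real
          using that by simp
        then show "2 * (J (X i) - d) + 2 * (J (X j) - d) < e\<^sup>2"
          using small[OF that(1)] small[OF that(2)] by blast
      qed
      then show ?thesis
        using \<open>0 < e\<close> by (simp add: dist_norm power2_less_imp_less)
    qed
    then show "\<exists>N. \<forall>i\<ge>N. \<forall>j\<ge>N. dist (X i) (X j) < e" by blast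
  qed
  then obtain w where w: "X \<longlonglongrightarrow> w"
    using Cauchy_convergent convergent_def by blast
  have "(\<lambda>i. J (X i)) \<longlonglongrightarrow> J w"
    unfolding J_def using w by (intro tendsto_intros tendsto)
  moreover have "(\<lambda>i. d + 1 / real (Suc i)) \<longlonglongrightarrow> d + 0"
    using LIMSEQ_inverse_real_of_nat by (intro tendsto_intros) (simp add: inverse_eq_divide)
  ultimately have Jw: "J w \<le> d"
    using X by (intro LIMSEQ_le[of "\<lambda>i. J (X i)" "J w" "\<lambda>i. d + 1 / real (Suc i)"]) (auto intro: less_imp_le)
  have "\<phi> g = inner g w" for g
  proof (rule ccontr)
    define a where "a = \<phi> g - inner g w"
    assume "\<phi> g \<noteq> inner g w"
    then have a: "a \<noteq> 0" by (simp add: a_def)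
    have quad: "2 * t * a \<le> t\<^sup>2 * (norm g)\<^sup>2" for t
    proof -
      have "J (w + t *\<^sub>R g) = J w - 2 * t * a + t\<^sup>2 * (norm g)\<^sup>2"
        unfolding J_def a_def power2_norm_eq_inner
        by (simp add: add scaleR inner_simps inner_commute[of g w] power2_eq_square algebra_simps)
      then show ?thesis
        using d_le[of "w + t *\<^sub>R g"] Jw by linarith
    qed
    \<comment> \<open>The step \<open>t = a / b\<close> is short enough for the linear term to dominate; the \<open>+ 1\<close> only avoids
      a division by zero.\<close>
    define b where "b = (norm g)\<^sup>2 + 1"
    have b: "b > 0" by (simp add: b_def add_nonneg_pos)
    have "2 * (a / b) * a \<le> (a / b)\<^sup>2 * (norm g)\<^sup>2" by (rule quad)
    also have "\<dots> \<le> (a / b)\<^sup>2 * b" by (intro mult_left_mono) (simp_all add: b_def)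
    also have "\<dots> = (a / b) * a" using b by (simp add: power2_eq_square)
    finally have "a\<^sup>2 / b \<le> 0" by (simp add: power2_eq_square)
    then show False using a b by (simp add: divide_le_0_iff)
  qed
  then show ?thesis by blast
qed

text \<open>The vectors appearing on the right are the truncations of \<open>f\<close> to a single entry; they replace
  multiples of unit vectors, since the entries may come from a space without a multiplication, such
  as \<open>L\<^sub>2\<close>.\<close>

lemma additive_vec_sum:
  fixes \<psi> :: "'a::ab_group_add vec \<Rightarrow> real"
  assumes add: "\<And>u v. u \<in> carrier_vec n \<Longrightarrow> v \<in> carrier_vec n \<Longrightarrow> \<psi> (u + v) = \<psi> u + \<psi> v"
    and f: "f \<in> carrier_vec n"
  shows "\<psi> f = (\<Sum>j<n. \<psi> (vec n (\<lambda>i. if i = j then f $ j else 0)))"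
proof -
  have "\<psi> (0\<^sub>v n + 0\<^sub>v n) = \<psi> (0\<^sub>v n) + \<psi> (0\<^sub>v n)"
    by (rule add) auto
  then have zero: "\<psi> (0\<^sub>v n) = 0"
    by simp
  have "\<psi> (vec n (\<lambda>i. if i < k then f $ i else 0))
      = (\<Sum>j<k. \<psi> (vec n (\<lambda>i. if i = j then f $ j else 0)))" if "k \<le> n" for k
    using that
  proof (induction k)
    case 0
    have "vec n (\<lambda>i. if i < 0 then f $ i else 0) = 0\<^sub>v n"
      by (intro eq_vecI) auto
    then show ?case by (simp add: zero)
  next
    case (Suc k)
    have "vec n (\<lambda>i. if i < Suc k then f $ i else 0)
        = vec n (\<lambda>i. if i < k then f $ i else 0) + vec n (\<lambda>i. if i = k then f $ k else 0)"
      by (intro eq_vecI) (auto simp: less_Suc_eq)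
    then show ?case
      using Suc by (simp add: add)
  qed
  from this[of n] have "\<psi> (vec n (\<lambda>i. if i < n then f $ i else 0))
      = (\<Sum>j<n. \<psi> (vec n (\<lambda>i. if i = j then f $ j else 0)))" by simp
  moreover have "vec n (\<lambda>i. if i < n then f $ i else 0) = f"
    using f by (intro eq_vecI) auto
  ultimately show ?thesis by simp
qed

text \<open>Both factors of \<open>\<real>L\<^sub>2\<^bsup>m,n\<^esup>\<close> consist of vectors over a complete inner product space, \<open>\<real>\<close> or \<open>L\<^sub>2\<close>. Each
  entry of the representing vector comes from Riesz representation of the restriction of \<open>\<psi>\<close> to
  vectors supported at that entry.\<close>

lemma riesz_representation_vec:
  fixes \<psi> :: "'a::{real_inner, complete_space} vec \<Rightarrow> real"
  assumes add: "\<And>u v. u \<in> carrier_vec n \<Longrightarrow> v \<in> carrier_vec n \<Longrightarrow> \<psi> (u + v) = \<psi> u + \<psi> v"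
    and scale: "\<And>c u. u \<in> carrier_vec n \<Longrightarrow> \<psi> (map_vec (scaleR c) u) = c * \<psi> u"
    and bound: "\<And>j g. j < n \<Longrightarrow> \<bar>\<psi> (vec n (\<lambda>i. if i = j then g else 0))\<bar> \<le> norm g * K"
  shows "\<exists>w\<in>carrier_vec n. \<forall>f\<in>carrier_vec n. \<psi> f = (\<Sum>j<n. inner (f $ j) (w $ j))"
proof -
  have "\<exists>w. \<forall>g. \<psi> (vec n (\<lambda>i. if i = j then g else 0)) = inner g w" if j: "j < n" for j
  proof (rule riesz_representation, rule bounded_linear_intro)
    fix g h :: 'a and c :: real
    have "vec n (\<lambda>i. if i = j then g + h else 0)
        = vec n (\<lambda>i. if i = j then g else 0) + vec n (\<lambda>i. if i = j then h else 0)"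
      by (intro eq_vecI) auto
    then show "\<psi> (vec n (\<lambda>i. if i = j then g + h else 0))
        = \<psi> (vec n (\<lambda>i. if i = j then g else 0)) + \<psi> (vec n (\<lambda>i. if i = j then h else 0))"
      by (simp add: add)
    have "vec n (\<lambda>i. if i = j then c *\<^sub>R g else 0)
        = map_vec (scaleR c) (vec n (\<lambda>i. if i = j then g else 0))"
      by (intro eq_vecI) auto
    then show "\<psi> (vec n (\<lambda>i. if i = j then c *\<^sub>R g else 0))
        = c *\<^sub>R \<psi> (vec n (\<lambda>i. if i = j then g else 0))"
      by (simp add: scale)
    show "norm (\<psi> (vec n (\<lambda>i. if i = j then g else 0))) \<le> norm g * K"
      using bound[OF j] by simp
  qed
  then obtain W where
    W: "\<And>j g. j < n \<Longrightarrow> \<psi> (vec n (\<lambda>i. if i = j then g else 0)) = inner g (W j)"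
    by metis
  have "\<psi> f = (\<Sum>j<n. inner (f $ j) (vec n W $ j))" if "f \<in> carrier_vec n" for f
    by (subst additive_vec_sum[OF add that]) (simp_all add: W)
  then show ?thesis
    by (intro bexI[of _ "vec n W"]) auto
qed

section \<open>The inner product of \<open>\<real>L\<^sub>2\<^bsup>m,n\<^esup>\<close>\<close>

lemma RL2_add: "u \<in> RL2 m n \<Longrightarrow> v \<in> RL2 m n \<Longrightarrow> u + v \<in> RL2 m n"
  by (cases u; cases v) (auto simp: RL2_def)

lemma RL2_scale: "u \<in> RL2 m n \<Longrightarrow> rl2_scale c u \<in> RL2 m n"
  by (cases u) (auto simp: RL2_def rl2_scale_def)

lemma rl2_inner_sums:
  assumes "v \<in> RL2 m n"
  shows "rl2_inner u v
    = (\<Sum>i<m. inner (fst u $ i) (fst v $ i)) + (\<Sum>j<n. inner (snd u $ j) (snd v $ j))"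
  using assms by (auto simp: rl2_inner_def RL2_def scalar_prod_def atLeast0LessThan)

lemma rl2_inner_commute:
  assumes "u \<in> RL2 m n" "v \<in> RL2 m n"
  shows "rl2_inner u v = rl2_inner v u"
  by (simp add: rl2_inner_sums[OF assms(1)] rl2_inner_sums[OF assms(2)] inner_commute mult.commute)

lemma rl2_inner_add_right:
  assumes "v \<in> RL2 m n" "w \<in> RL2 m n"
  shows "rl2_inner u (v + w) = rl2_inner u v + rl2_inner u w"
  unfolding rl2_inner_sums[OF RL2_add[OF assms]] rl2_inner_sums[OF assms(1)] rl2_inner_sums[OF assms(2)]
  using assms by (auto simp: RL2_def inner_add_right distrib_left sum.distrib)

lemma rl2_inner_scale_right:
  assumes "v \<in> RL2 m n"
  shows "rl2_inner u (rl2_scale c v) = c * rl2_inner u v"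
  unfolding rl2_inner_sums[OF RL2_scale[OF assms]] rl2_inner_sums[OF assms(1)]
  using assms
  by (auto simp: RL2_def rl2_scale_def sum_distrib_left distrib_left mult_ac intro!: sum.cong)

lemma rl2_inner_minus_right:
  assumes "v \<in> RL2 m n"
  shows "rl2_inner u (- v) = - rl2_inner u v"
proof -
  have "- v \<in> RL2 m n"
    using assms by (cases v) (auto simp: RL2_def)
  from rl2_inner_sums[OF this] show ?thesis
    unfolding rl2_inner_sums[OF assms]
    using assms by (auto simp: RL2_def sum_negf)
qed

lemma rl2_inner_zero_left:
  assumes "v \<in> RL2 m n"
  shows "rl2_inner (rl2_zero m n) v = 0"
  unfolding rl2_inner_sums[OF assms] by (simp add: rl2_zero_def)

lemma rl2_inner_self_nonneg:
  assumes "u \<in> RL2 m n"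
  shows "0 \<le> rl2_inner u u"
  unfolding rl2_inner_sums[OF assms] by (intro add_nonneg_nonneg sum_nonneg) auto

lemma rl2_norm_L2_set:
  assumes "u \<in> RL2 m n"
  shows "rl2_norm u = L2_set (case_sum (\<lambda>i. norm (fst u $ i)) (\<lambda>j. norm (snd u $ j)))
    ({..<m} <+> {..<n})"
  unfolding rl2_norm_def rl2_inner_sums[OF assms] L2_set_def
  by (simp only: sum.Plus finite_lessThan sum.case comp_def power2_norm_eq_inner)

text \<open>Cauchy-Schwarz is applied in each entry, and then once more to the finite families of
  entry norms, indexed jointly over both factors.\<close>

lemma rl2_cauchy_schwarz:
  assumes "u \<in> RL2 m n" "v \<in> RL2 m n"
  shows "\<bar>rl2_inner u v\<bar> \<le> rl2_norm u * rl2_norm v"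
proof -
  let ?nu = "case_sum (\<lambda>i. norm (fst u $ i)) (\<lambda>j. norm (snd u $ j))"
  let ?nv = "case_sum (\<lambda>i. norm (fst v $ i)) (\<lambda>j. norm (snd v $ j))"
  have "\<bar>rl2_inner u v\<bar> \<le> (\<Sum>i<m. \<bar>inner (fst u $ i) (fst v $ i)\<bar>)
      + (\<Sum>j<n. \<bar>inner (snd u $ j) (snd v $ j)\<bar>)"
    unfolding rl2_inner_sums[OF assms(2)]
    by (intro order_trans[OF abs_triangle_ineq] add_mono sum_abs)
  also have "\<dots> \<le> (\<Sum>i<m. norm (fst u $ i) * norm (fst v $ i))
      + (\<Sum>j<n. norm (snd u $ j) * norm (snd v $ j))"
    by (intro add_mono sum_mono Cauchy_Schwarz_ineq2)
  also have "\<dots> = (\<Sum>i\<in>{..<m} <+> {..<n}. \<bar>?nu i\<bar> * \<bar>?nv i\<bar>)"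
    by (simp add: sum.Plus)
  also have "\<dots> \<le> rl2_norm u * rl2_norm v"
    unfolding rl2_norm_L2_set[OF assms(1)] rl2_norm_L2_set[OF assms(2)]
    by (rule L2_set_mult_ineq)
  finally show ?thesis .
qed

lemma rl2_norm_single:
  assumes "j < n"
  shows "rl2_norm (0\<^sub>v m, vec n (\<lambda>i. if i = j then g else 0)) = norm g"
proof -
  have "(\<Sum>i<n. inner (if i = j then g else 0) (if i = j then g else 0)) = inner g g"
    using assms by (subst sum.remove[of _ j]) auto
  then show ?thesis
    by (simp add: rl2_norm_def rl2_inner_def norm_eq_sqrt_inner)
qed

lemma rl2_norm_single_fst:
  assumes "j < m"
  shows "rl2_norm (vec m (\<lambda>i. if i = j then g else 0), 0\<^sub>v n) = norm g"
proof -
  have "(\<Sum>i<m. (if i = j then g else 0) * (if i = j then g else 0)) = g * g"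
    using assms by (subst sum.remove[of _ j]) auto
  then show ?thesis
    by (simp add: rl2_norm_def rl2_inner_def scalar_prod_def atLeast0LessThan)
qed

lemma rl2_inner_eqI:
  assumes w: "w \<in> RL2 m n" and w': "w' \<in> RL2 m n"
    and eq: "\<And>u. u \<in> RL2 m n \<Longrightarrow> rl2_inner u w = rl2_inner u w'"
  shows "w = w'"
proof -
  define d where "d = w + rl2_scale (-1) w'"
  have d: "d \<in> RL2 m n"
    unfolding d_def by (intro RL2_add RL2_scale w w')
  have "rl2_inner d d = 0"
    unfolding rl2_inner_add_right[OF w RL2_scale[OF w'], of d "-1", folded d_def]
      rl2_inner_scale_right[OF w'] using eq[OF d] by simp
  then have "(\<Sum>i<m. inner (fst d $ i) (fst d $ i)) = 0 \<and> (\<Sum>j<n. inner (snd d $ j) (snd d $ j)) = 0"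
    unfolding rl2_inner_sums[OF d] by (subst (asm) add_nonneg_eq_0_iff) (auto intro: sum_nonneg)
  then have z: "(\<forall>i<m. fst d $ i = 0) \<and> (\<forall>j<n. snd d $ j = 0)"
    by (simp add: sum_nonneg_eq_0_iff)
  show ?thesis
  proof (rule prod_eqI)
    show "fst w = fst w'"
      using z w w' by (intro eq_vecI) (auto simp: d_def RL2_def rl2_scale_def)
    show "snd w = snd w'"
      using z w w' by (intro eq_vecI) (auto simp: d_def RL2_def rl2_scale_def)
  qed
qed

section \<open>Hilbert space adjoints\<close>

lemma riesz_representation_RL2:
  assumes add: "\<And>u v. u \<in> RL2 m n \<Longrightarrow> v \<in> RL2 m n \<Longrightarrow> \<phi> (u + v) = \<phi> u + \<phi> v"
    and scale: "\<And>c u. u \<in> RL2 m n \<Longrightarrow> \<phi> (rl2_scale c u) = c * \<phi> u"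
    and bound: "\<And>u. u \<in> RL2 m n \<Longrightarrow> \<bar>\<phi> u\<bar> \<le> rl2_norm u * K"
  shows "\<exists>w\<in>RL2 m n. \<forall>u\<in>RL2 m n. \<phi> u = rl2_inner u w"
proof -
  have "\<exists>y\<in>carrier_vec m. \<forall>x\<in>carrier_vec m. \<phi> (x, 0\<^sub>v n) = (\<Sum>j<m. inner (x $ j) (y $ j))"
  proof (rule riesz_representation_vec)
    fix x x' :: "real vec" and c :: real
    assume x: "x \<in> carrier_vec m" "x' \<in> carrier_vec m"
    show "\<phi> (x + x', 0\<^sub>v n) = \<phi> (x, 0\<^sub>v n) + \<phi> (x', 0\<^sub>v n)"
      using add[of "(x, 0\<^sub>v n)" "(x', 0\<^sub>v n)"] x by (simp add: RL2_def)
  next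
    fix x :: "real vec" and c :: real
    assume x: "x \<in> carrier_vec m"
    have "rl2_scale c (x, 0\<^sub>v n) = (map_vec (scaleR c) x, 0\<^sub>v n)"
      by (auto simp: rl2_scale_def)
    then show "\<phi> (map_vec (scaleR c) x, 0\<^sub>v n) = c * \<phi> (x, 0\<^sub>v n)"
      using scale[of "(x, 0\<^sub>v n)" c] x by (simp add: RL2_def)
  next
    fix j and g :: real
    assume "j < m"
    then show "\<bar>\<phi> (vec m (\<lambda>i. if i = j then g else 0), 0\<^sub>v n)\<bar> \<le> norm g * K"
      using bound[of "(vec m (\<lambda>i. if i = j then g else 0), 0\<^sub>v n)"] rl2_norm_single_fst[of j m g n]
      by (simp add: RL2_def)
  qed
  then obtain y where y: "y \<in> carrier_vec m"
    "\<And>x. x \<in> carrier_vec m \<Longrightarrow> \<phi> (x, 0\<^sub>v n) = (\<Sum>j<m. inner (x $ j) (y $ j))"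
    by blast
  have "\<exists>h\<in>carrier_vec n. \<forall>f\<in>carrier_vec n. \<phi> (0\<^sub>v m, f) = (\<Sum>j<n. inner (f $ j) (h $ j))"
  proof (rule riesz_representation_vec)
    fix f f' :: "L2 vec" and c :: real
    assume f: "f \<in> carrier_vec n" "f' \<in> carrier_vec n"
    show "\<phi> (0\<^sub>v m, f + f') = \<phi> (0\<^sub>v m, f) + \<phi> (0\<^sub>v m, f')"
      using add[of "(0\<^sub>v m, f)" "(0\<^sub>v m, f')"] f by (simp add: RL2_def)
  next
    fix f :: "L2 vec" and c :: real
    assume f: "f \<in> carrier_vec n"
    have "rl2_scale c (0\<^sub>v m, f) = (0\<^sub>v m, map_vec (scaleR c) f)"
      by (auto simp: rl2_scale_def)
    then show "\<phi> (0\<^sub>v m, map_vec (scaleR c) f) = c * \<phi> (0\<^sub>v m, f)"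
      using scale[of "(0\<^sub>v m, f)" c] f by (simp add: RL2_def)
  next
    fix j and g :: L2
    assume "j < n"
    then show "\<bar>\<phi> (0\<^sub>v m, vec n (\<lambda>i. if i = j then g else 0))\<bar> \<le> norm g * K"
      using bound[of "(0\<^sub>v m, vec n (\<lambda>i. if i = j then g else 0))"] rl2_norm_single[of j n m g]
      by (simp add: RL2_def)
  qed
  then obtain h where h: "h \<in> carrier_vec n"
    "\<And>f. f \<in> carrier_vec n \<Longrightarrow> \<phi> (0\<^sub>v m, f) = (\<Sum>j<n. inner (f $ j) (h $ j))"
    by blast
  have w: "(y, h) \<in> RL2 m n"
    using y h by (simp add: RL2_def)
  have "\<phi> u = rl2_inner u (y, h)" if u_in: "u \<in> RL2 m n" for u
  proof -
    obtain x f where u: "u = (x, f)" and xf: "x \<in> carrier_vec m" "f \<in> carrier_vec n"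
      using u_in by (auto simp: RL2_def)
    have "u = (x, 0\<^sub>v n) + (0\<^sub>v m, f)"
      using xf by (auto simp: u)
    then have "\<phi> u = \<phi> (x, 0\<^sub>v n) + \<phi> (0\<^sub>v m, f)"
      using add[of "(x, 0\<^sub>v n)" "(0\<^sub>v m, f)"] xf by (simp add: RL2_def)
    then show ?thesis
      unfolding rl2_inner_sums[OF w] using y(2)[OF xf(1)] h(2)[OF xf(2)] by (simp add: u)
  qed
  with w show ?thesis by blast
qed

text \<open>The adjoint is defined by a definite description, so every use of it rests on existence and
  uniqueness. For fixed \<open>v\<close>, the functional \<open>u \<mapsto> \<langle>T u, v\<rangle>\<close> is bounded and hence represented by a unique
  vector \<open>A v\<close>. Linearity of \<open>A\<close> follows from uniqueness, and its boundedness from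
  \<open>\<parallel>A v\<parallel>\<^sup>2 = \<langle>T (A v), v\<rangle> \<le> C \<parallel>A v\<parallel> \<parallel>v\<parallel>\<close>.\<close>

lemma hadj_properties:
  assumes T: "T \<in> bounded_ops m n p q"
  shows "hadj m n p q T \<in> bounded_ops p q m n \<and>
    (\<forall>u\<in>RL2 m n. \<forall>v\<in>RL2 p q. rl2_inner (T u) v = rl2_inner u (hadj m n p q T v))"
proof -
  have T_in: "\<And>u. u \<in> RL2 m n \<Longrightarrow> T u \<in> RL2 p q"
    and T_add: "\<And>u v. u \<in> RL2 m n \<Longrightarrow> v \<in> RL2 m n \<Longrightarrow> T (u + v) = T u + T v"
    and T_scale: "\<And>c u. u \<in> RL2 m n \<Longrightarrow> T (rl2_scale c u) = rl2_scale c (T u)"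
    using T by (auto simp: bounded_ops_def)
  obtain C where C: "\<And>u. u \<in> RL2 m n \<Longrightarrow> rl2_norm (T u) \<le> C * rl2_norm u"
    using T unfolding bounded_ops_def by blast
  have norm_nonneg: "0 \<le> rl2_norm u" if "u \<in> RL2 a b" for u a b
    using rl2_inner_self_nonneg[OF that] by (simp add: rl2_norm_def)
  have bound: "\<bar>rl2_inner (T u) v\<bar> \<le> rl2_norm u * (C * rl2_norm v)"
    if u: "u \<in> RL2 m n" and v: "v \<in> RL2 p q" for u v
  proof -
    have "\<bar>rl2_inner (T u) v\<bar> \<le> rl2_norm (T u) * rl2_norm v"
      by (rule rl2_cauchy_schwarz[OF T_in[OF u] v])
    also have "\<dots> \<le> (C * rl2_norm u) * rl2_norm v"
      by (intro mult_right_mono norm_nonneg[OF v] C[OF u])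
    finally show ?thesis by (simp add: mult_ac)
  qed
  have left_add: "rl2_inner (a + b) v = rl2_inner a v + rl2_inner b v"
    if "a \<in> RL2 p q" "b \<in> RL2 p q" "v \<in> RL2 p q" for a b v
    using that rl2_inner_add_right[of a p q b v] RL2_add[of a p q b]
    by (simp add: rl2_inner_commute[of _ p q v])
  have left_scale: "rl2_inner (rl2_scale c a) v = c * rl2_inner a v"
    if "a \<in> RL2 p q" "v \<in> RL2 p q" for a v c
    using that rl2_inner_scale_right[of a p q v c] RL2_scale[of a p q c]
    by (simp add: rl2_inner_commute[of _ p q v])
  have "\<exists>w\<in>RL2 m n. \<forall>u\<in>RL2 m n. rl2_inner (T u) v = rl2_inner u w" if v: "v \<in> RL2 p q" for v
  proof (rule riesz_representation_RL2)
    show "\<bar>rl2_inner (T u) v\<bar> \<le> rl2_norm u * (C * rl2_norm v)" if "u \<in> RL2 m n" for u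
      by (rule bound[OF that v])
  qed (simp_all add: T_add T_scale T_in left_add left_scale v)
  then obtain B where B_in: "\<And>v. v \<in> RL2 p q \<Longrightarrow> B v \<in> RL2 m n"
    and B: "\<And>u v. u \<in> RL2 m n \<Longrightarrow> v \<in> RL2 p q \<Longrightarrow> rl2_inner (T u) v = rl2_inner u (B v)"
    by metis
  define A where "A = restrict B (RL2 p q)"
  have A_in: "A v \<in> RL2 m n" if "v \<in> RL2 p q" for v
    using that B_in by (simp add: A_def)
  have A: "rl2_inner u (A v) = rl2_inner (T u) v" if "u \<in> RL2 m n" "v \<in> RL2 p q" for u v
    using that B by (simp add: A_def)
  have "A \<in> bounded_ops p q m n"
    unfolding bounded_ops_def
  proof (intro CollectI conjI ballI allI)
    show "A \<in> RL2 p q \<rightarrow>\<^sub>E RL2 m n"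
      using B_in by (auto simp: A_def)
  next
    fix v v' assume v: "v \<in> RL2 p q" "v' \<in> RL2 p q"
    show "A (v + v') = A v + A v'"
    proof (rule rl2_inner_eqI)
      fix u assume "u \<in> RL2 m n"
      then show "rl2_inner u (A (v + v')) = rl2_inner u (A v + A v')"
        using v by (simp add: A RL2_add A_in rl2_inner_add_right[of _ m n] rl2_inner_add_right[of _ p q])
    qed (simp_all add: A_in RL2_add v)
  next
    fix c v assume v: "v \<in> RL2 p q"
    show "A (rl2_scale c v) = rl2_scale c (A v)"
    proof (rule rl2_inner_eqI)
      fix u assume "u \<in> RL2 m n"
      then show "rl2_inner u (A (rl2_scale c v)) = rl2_inner u (rl2_scale c (A v))"
        using v by (simp add: A RL2_scale A_in rl2_inner_scale_right[of _ m n] rl2_inner_scale_right[of _ p q])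
    qed (simp_all add: A_in RL2_scale v)
  next
    \<comment> \<open>The absolute value covers a negative \<open>C\<close>, which is possible when \<open>\<real>L\<^sub>2\<^bsup>m,n\<^esup>\<close> is the zero space.\<close>
    have "rl2_norm (A v) \<le> \<bar>C\<bar> * rl2_norm v" if v: "v \<in> RL2 p q" for v
    proof (cases "rl2_norm (A v) = 0")
      case True
      then show ?thesis using norm_nonneg[OF v] by simp
    next
      case False
      then have pos: "0 < rl2_norm (A v)"
        using norm_nonneg[OF A_in[OF v]] by simp
      have "rl2_norm (A v) * rl2_norm (A v) = rl2_inner (T (A v)) v"
        using rl2_inner_self_nonneg[OF A_in[OF v]] A[OF A_in[OF v] v] by (simp add: rl2_norm_def)
      also have "\<dots> \<le> rl2_norm (A v) * (C * rl2_norm v)"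
        using bound[OF A_in[OF v] v] by simp
      finally have "rl2_norm (A v) \<le> C * rl2_norm v"
        using pos by simp
      also have "\<dots> \<le> \<bar>C\<bar> * rl2_norm v"
        by (intro mult_right_mono norm_nonneg[OF v]) simp
      finally show ?thesis .
    qed
    then show "\<exists>C. \<forall>v\<in>RL2 p q. rl2_norm (A v) \<le> C * rl2_norm v" by blast
  qed
  moreover have "\<forall>u\<in>RL2 m n. \<forall>v\<in>RL2 p q. rl2_inner (T u) v = rl2_inner u (A v)"
    by (simp add: A)
  moreover have "A' = A" if A': "A' \<in> bounded_ops p q m n"
    "\<forall>u\<in>RL2 m n. \<forall>v\<in>RL2 p q. rl2_inner (T u) v = rl2_inner u (A' v)" for A'
  proof (rule PiE_ext)
    show "A' \<in> RL2 p q \<rightarrow>\<^sub>E RL2 m n" "A \<in> RL2 p q \<rightarrow>\<^sub>E RL2 m n"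
      using A'(1) \<open>A \<in> bounded_ops p q m n\<close> by (auto simp: bounded_ops_def)
    fix v assume v: "v \<in> RL2 p q"
    show "A' v = A v"
      using A' v by (intro rl2_inner_eqI[of _ m n]) (auto simp: A_in A bounded_ops_def)
  qed
  ultimately show ?thesis
    unfolding hadj_def by (rule theI2[where a = A, OF conjI]) auto
qed

section \<open>Elimination of the multiplier\<close>

lemma bounded_ops_zero:
  assumes "T \<in> bounded_ops m n p q"
  shows "T (rl2_zero m n) = rl2_zero p q"
proof -
  have z: "rl2_scale 0 u = rl2_zero a b" if "u \<in> RL2 a b" for u a b
    using that by (auto simp: RL2_def rl2_scale_def rl2_zero_def)
  have 0: "rl2_zero m n \<in> RL2 m n"
    by (simp add: RL2_def rl2_zero_def)
  have "T (rl2_scale 0 (rl2_zero m n)) = rl2_scale 0 (T (rl2_zero m n))"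
    using assms 0 by (auto simp: bounded_ops_def)
  moreover have "T (rl2_zero m n) \<in> RL2 p q"
    using assms 0 by (auto simp: bounded_ops_def)
  ultimately show ?thesis
    using z[OF 0] z[of "T (rl2_zero m n)" p q] by simp
qed

text \<open>At \<open>w = N u\<close> the two terms containing \<open>X\<close> contribute \<open>2 \<langle>U w, X (V w)\<rangle>\<close> to the quadratic form, which
  vanishes as soon as one of \<open>U w\<close> and \<open>V w\<close> is zero. Stating the alternative as a disjunction lets one
  argument serve both annihilators.\<close>

lemma compression_nonpos:
  assumes Q: "Q \<in> bounded_ops m n m n" and U: "U \<in> bounded_ops m n r s"
    and V: "V \<in> bounded_ops m n p q" and X: "X \<in> bounded_ops p q r s"
    and N: "N \<in> bounded_ops k l m n"
    and le: "op_nonpos m n (\<lambda>u. Q u + hadj m n r s U (X (V u)) + hadj m n p q V (hadj p q r s X (U u)))"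
    and ann: "(\<forall>u\<in>RL2 k l. U (N u) = rl2_zero r s) \<or> (\<forall>u\<in>RL2 k l. V (N u) = rl2_zero p q)"
  shows "op_nonpos k l (\<lambda>u. hadj k l m n N (Q (N u)))"
  unfolding op_nonpos_def op_nonneg_def
proof
  fix u assume u: "u \<in> RL2 k l"
  have op_in: "T v \<in> RL2 c d" if "T \<in> bounded_ops a b c d" "v \<in> RL2 a b" for T v a b c d
    using that by (auto simp: bounded_ops_def)
  define w where "w = N u"
  have w: "w \<in> RL2 m n" unfolding w_def by (rule op_in[OF N u])
  note Uw = op_in[OF U w] and Vw = op_in[OF V w]
  note XVw = op_in[OF X Vw]
  have hX: "hadj p q r s X (U w) \<in> RL2 p q"
    using hadj_properties[OF X] Uw op_in by blast
  have hU: "hadj m n r s U (X (V w)) \<in> RL2 m n"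
    using hadj_properties[OF U] XVw op_in by blast
  have hV: "hadj m n p q V (hadj p q r s X (U w)) \<in> RL2 m n"
    using hadj_properties[OF V] hX op_in by blast
  note Qw = op_in[OF Q w]
  have t1: "rl2_inner w (hadj m n r s U (X (V w))) = rl2_inner (U w) (X (V w))"
    using hadj_properties[OF U] w XVw by simp
  have t2: "rl2_inner w (hadj m n p q V (hadj p q r s X (U w))) = rl2_inner (U w) (X (V w))"
    using hadj_properties[OF V] hadj_properties[OF X] w Uw Vw hX XVw
    by (simp add: rl2_inner_commute[of "U w" r s])
  have cross: "rl2_inner (U w) (X (V w)) = 0"
    using ann
  proof
    assume "\<forall>u\<in>RL2 k l. U (N u) = rl2_zero r s"
    then show ?thesis
      using u XVw by (simp add: w_def rl2_inner_zero_left)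
  next
    assume "\<forall>u\<in>RL2 k l. V (N u) = rl2_zero p q"
    then have "X (V w) = rl2_zero r s"
      using u by (simp add: w_def bounded_ops_zero[OF X])
    then show ?thesis
      using Uw XVw by (simp add: rl2_inner_commute[of "U w" r s] rl2_inner_zero_left)
  qed
  have "0 \<le> rl2_inner w (- (Q w + hadj m n r s U (X (V w)) + hadj m n p q V (hadj p q r s X (U w))))"
    using le w by (simp add: op_nonpos_def op_nonneg_def)
  then have "rl2_inner w (Q w) \<le> 0"
    by (simp add: rl2_inner_minus_right[OF RL2_add[OF RL2_add[OF Qw hU] hV]]
        rl2_inner_add_right[OF RL2_add[OF Qw hU] hV] rl2_inner_add_right[OF Qw hU] t1 t2 cross)
  moreover have "rl2_inner w (Q w) = rl2_inner u (hadj k l m n N (Q w))"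
    using hadj_properties[OF N] u Qw by (simp add: w_def)
  moreover have "hadj k l m n N (Q w) \<in> RL2 k l"
    using hadj_properties[OF N] Qw op_in by blast
  ultimately show "0 \<le> rl2_inner u (- hadj k l m n N (Q (N u)))"
    by (simp add: rl2_inner_minus_right flip: w_def)
qed

theorem lemma10:
  fixes m n p q r s k\<^sub>1 l\<^sub>1 k\<^sub>2 l\<^sub>2 :: nat
    and V U Q R S :: "real vec \<times> L2 vec \<Rightarrow> real vec \<times> L2 vec"
  assumes V: "V \<in> four_PI m n p q"
    and U: "U \<in> four_PI m n r s"
    and Q: "Q \<in> four_PI m n m n" and Q_selfadj: "Q = hadj m n m n Q"
    and R: "right_annihilator k\<^sub>1 l\<^sub>1 m n r s U R"
    and S: "right_annihilator k\<^sub>2 l\<^sub>2 m n p q V S"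
    and X: "\<exists>X\<in>four_PI p q r s.
      op_nonpos m n (\<lambda>u. Q u + hadj m n r s U (X (V u))
                             + hadj m n p q V (hadj p q r s X (U u)))"
  shows "op_nonpos k\<^sub>2 l\<^sub>2 (\<lambda>u. hadj k\<^sub>2 l\<^sub>2 m n S (Q (S u)))
    \<and> op_nonpos k\<^sub>1 l\<^sub>1 (\<lambda>u. hadj k\<^sub>1 l\<^sub>1 m n R (Q (R u)))"
proof -
  have bounded: "T \<in> bounded_ops a b c d" if "T \<in> four_PI a b c d" for T a b c d
    using that by (simp add: four_PI_def)
  obtain X where X: "X \<in> bounded_ops p q r s"
    and le: "op_nonpos m n (\<lambda>u. Q u + hadj m n r s U (X (V u))
                             + hadj m n p q V (hadj p q r s X (U u)))"
    using X bounded by blast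
  note compression = compression_nonpos[OF bounded[OF Q] bounded[OF U] bounded[OF V] X _ le]
  show ?thesis
    using R S by (intro conjI compression) (auto simp: right_annihilator_def bounded)
qed

end
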